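(* For all $P(x)\in\mathcal{R}_q$, we have $\overline{S P(x)}=S^{-1}\,\overline{P(x)}$. Thus for all $m\in\mathbb{Z}$, the map $P(x)\mapsto S^{m}\overline{P(x)}$ is an involution $\mathcal{R}_q\to\mathcal{R}_q$.
   Context: Here $q$ and $x$ are commuting indeterminates, and for $n\in\mathbb{Z}$, $[n]_q:=(q^n-1)/(q-1)\in\mathbb{Z}[q,q^{-1}]$. $\mathcal{R}_q:=\{P(x)\in\mathbb{Q}(q)[x] : P([n]_q)\in\mathbb{Z}[q,q^{-1}]\text{ for all }n\in\mathbb{Z}\}$. The shift operator $S$ is the $\mathbb{Q}(q)$-linear ring automorphism of $\mathbb{Q}(q)[x]$ with $S(x)=qx+1$ and inverse $S^{-1}(x)=q^{-1}(x-1)$; it restricts to an automorphism of $\mathcal{R}_q$. The bar involution $P\mapsto\overline{P}$ is the ring involution of $\mathbb{Q}(q)[x]$ determined by $\overline{q}=q^{-1}$ (extended to the field involution of $\mathbb{Q}(q)$) and $\overline{x}=-qx$; it restricts to a ring involution of $\mathcal{R}_q$. *)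

theory Defs
  imports "HOL-Computational_Algebra.Computational_Algebra" "HOL-Computational_Algebra.Field_as_Ring"
begin

section \<open>The field of rational functions in q\<close>

type_synonym ratq = "rat poly fract"

definition const_q :: "rat \<Rightarrow> ratq" where
  "const_q c = to_fract [:c:]"

definition q :: ratq where
  "q = to_fract [:0, 1:]"

definition qint :: "int \<Rightarrow> ratq" where
  "qint n = (q powi n - 1) / (q - 1)"

text \<open>The subring of Laurent polynomials with integer coefficients: the fractions whose
  denominator is a power of q.\<close>

definition laurent_int :: "ratq set" where
  "laurent_int = {to_fract (map_poly of_int p) / q ^ k | (p :: int poly) (k :: nat). True}"

definition Rq :: "ratq poly set" where
  "Rq = {P. \<forall>n::int. poly P (qint n) \<in> laurent_int}"


section \<open>Shift operator\<close>

definition shift :: "ratq poly \<Rightarrow> ratq poly" where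
  "shift P = pcompose P [:1, q:]"

definition shift_inv :: "ratq poly \<Rightarrow> ratq poly" where
  "shift_inv P = pcompose P [:- inverse q, inverse q:]"

definition shift_pow :: "int \<Rightarrow> ratq poly \<Rightarrow> ratq poly" where
  "shift_pow m = (if m \<ge> 0 then shift ^^ nat m else shift_inv ^^ nat (- m))"


section \<open>Bar involution\<close>

definition subst_inv :: "rat poly \<Rightarrow> ratq" where
  "subst_inv p = poly (map_poly const_q p) (inverse q)"

text \<open>The field involution: both numerator and denominator are evaluated at the inverse of q.
  The result does not depend on the fraction chosen (lemma \<open>bar_coeff_Fract\<close>).\<close>

definition bar_coeff :: "ratq \<Rightarrow> ratq" where
  "bar_coeff r = subst_inv (fst (quot_of_fract r)) / subst_inv (snd (quot_of_fract r))"

definition bar :: "ratq poly \<Rightarrow> ratq poly" where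
  "bar P = pcompose (map_poly bar_coeff P) [:0, - q:]"


section \<open>The definitions agree with their characterisations\<close>

lemma const_q_0 [simp]: "const_q 0 = 0"
  and const_q_1 [simp]: "const_q 1 = 1"
  and const_q_add: "const_q (a + b) = const_q a + const_q b"
  and const_q_mult: "const_q (a * b) = const_q a * const_q b"
  by (simp_all add: const_q_def flip: to_fract_add to_fract_mult one_pCons)

lemma const_q_eq_0_iff [simp]: "const_q a = 0 \<longleftrightarrow> a = 0"
  by (simp add: const_q_def)

lemma q_nonzero [simp]: "q \<noteq> 0"
  by (simp add: q_def)

lemma q_neq_1 [simp]: "q \<noteq> 1"
proof
  assume "q = 1"
  then have "to_fract [:0, 1 :: rat:] = to_fract 1" by (simp add: q_def)
  then have "[:0, 1 :: rat:] = 1" by (simp only: to_fract_eq_iff)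
  then show False by (simp add: one_pCons)
qed

lemma poly_const_q_q: "poly (map_poly const_q p) q = to_fract p"
proof (induction p)
  case (pCons a p)
  have "pCons a p = [:a:] + [:0, 1:] * p" by simp
  then have "to_fract (pCons a p) = to_fract ([:a:]) + to_fract ([:0, 1:]) * to_fract p"
    by (metis to_fract_add to_fract_mult)
  with pCons show ?case by (simp add: map_poly_pCons q_def const_q_def)
qed simp

lemma subst_inv_pCons [simp]: "subst_inv (pCons a p) = const_q a + inverse q * subst_inv p"
  by (cases "a = 0 \<and> p = 0") (auto simp: subst_inv_def map_poly_pCons)

lemma subst_inv_0 [simp]: "subst_inv 0 = 0"
  by (simp add: subst_inv_def)

lemma subst_inv_1 [simp]: "subst_inv 1 = 1"
  by (simp add: one_pCons)

lemma subst_inv_add: "subst_inv (p + r) = subst_inv p + subst_inv r"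
  by (induction p r rule: poly_induct2) (simp_all add: const_q_add algebra_simps)

lemma subst_inv_smult: "subst_inv (smult a p) = const_q a * subst_inv p"
  by (induction p) (simp_all add: const_q_mult algebra_simps)

lemma subst_inv_mult: "subst_inv (p * r) = subst_inv p * subst_inv r"
  by (induction p) (simp_all add: subst_inv_add subst_inv_smult algebra_simps)

lemma subst_inv_eq_0_iff [simp]: "subst_inv p = 0 \<longleftrightarrow> p = 0"
proof
  assume p: "subst_inv p = 0"
  have "reflect_poly (map_poly const_q p) = map_poly const_q (reflect_poly p)"
    by (rule poly_eqI)
       (simp add: coeff_reflect_poly coeff_map_poly degree_map_poly)
  then have "to_fract (reflect_poly p) = q ^ degree p * subst_inv p"
    using poly_reflect_poly_nz[of q "map_poly const_q p"]
    by (simp add: poly_const_q_q subst_inv_def degree_map_poly)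
  with p show "p = 0" by simp
qed simp

lemma bar_coeff_Fract:
  assumes "b \<noteq> 0"
  shows "bar_coeff (Fract a b) = subst_inv a / subst_inv b"
proof -
  obtain c d where cd: "quot_of_fract (Fract a b) = (c, d)" by (cases "quot_of_fract (Fract a b)")
  have d: "d \<noteq> 0" using snd_quot_of_fract_nonzero[of "Fract a b"] cd by simp
  have "Fract c d = Fract a b" using Fract_quot_of_fract[of "Fract a b"] cd by simp
  then have "c * b = a * d" using assms d by (simp add: eq_fract)
  then have "subst_inv c * subst_inv b = subst_inv a * subst_inv d"
    by (metis subst_inv_mult)
  then show ?thesis using assms d by (simp add: bar_coeff_def cd frac_eq_eq)
qed

lemma bar_coeff_0 [simp]: "bar_coeff 0 = 0"
  and bar_coeff_1 [simp]: "bar_coeff 1 = 1"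
  by (simp_all add: bar_coeff_def)

lemma bar_coeff_q [simp]: "bar_coeff q = inverse q"
  by (simp add: bar_coeff_def q_def)

lemma bar_coeff_add: "bar_coeff (r + s) = bar_coeff r + bar_coeff s"
  by (cases r; cases s) (simp add: bar_coeff_Fract subst_inv_add subst_inv_mult add_frac_eq)

lemma bar_coeff_mult: "bar_coeff (r * s) = bar_coeff r * bar_coeff s"
  by (cases r; cases s) (simp add: bar_coeff_Fract subst_inv_mult)

lemma map_poly_bar_coeff_add:
  "map_poly bar_coeff (P + Q) = map_poly bar_coeff P + map_poly bar_coeff Q"
  by (rule poly_eqI) (simp add: coeff_map_poly bar_coeff_add)

lemma map_poly_bar_coeff_smult:
  "map_poly bar_coeff (smult c P) = smult (bar_coeff c) (map_poly bar_coeff P)"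
  by (rule poly_eqI) (simp add: coeff_map_poly bar_coeff_mult)

lemma map_poly_bar_coeff_mult:
  "map_poly bar_coeff (P * Q) = map_poly bar_coeff P * map_poly bar_coeff Q"
proof (induction P)
  case (pCons a P)
  then show ?case
    by (simp add: map_poly_pCons map_poly_bar_coeff_add map_poly_bar_coeff_smult)
qed simp

lemma bar_add: "bar (P + Q) = bar P + bar Q"
  and bar_mult: "bar (P * Q) = bar P * bar Q"
  and bar_x: "bar [:0, 1:] = [:0, - q:]"
  and bar_const: "bar [:c:] = [:bar_coeff c:]"
  by (simp_all add: bar_def map_poly_bar_coeff_add map_poly_bar_coeff_mult
        pcompose_add pcompose_mult pcompose_pCons map_poly_pCons)

lemma shift_shift_inv: "shift (shift_inv P) = P"
  and shift_inv_shift: "shift_inv (shift P) = P"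
  by (simp_all add: shift_def shift_inv_def pcompose_pCons flip: pcompose_assoc)

lemma shift_inv_eq_inv: "shift_inv = inv shift"
  by (rule inv_unique_comp[symmetric])
     (simp_all add: fun_eq_iff shift_shift_inv shift_inv_shift)

end

theory Submission
  imports Defs
begin

text \<open>
  Both parts rest on looking at the two operators through their action on the generators of the
  ring and on the evaluation points.

  The shift is a ring endomorphism that fixes scalars, and the bar operator is a ring endomorphism
  that is semilinear over \<open>q \<mapsto> q\<inverse>\<close>. Hence the relation \<open>bar \<circ> shift = shift_inv \<circ> bar\<close> has to be
  checked on scalars, where it is trivial, and on \<open>x\<close>, where both sides equal \<open>1 - x\<close>; it therefore
  holds for all polynomials over the field, as do \<open>bar \<circ> bar = id\<close> and the consequence
  \<open>bar \<circ> shift\<^sup>m = shift\<^sup>-\<^sup>m \<circ> bar\<close>. This makes the square of \<open>shift\<^sup>m \<circ> bar\<close> the identity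
  (\<open>bar_shift\<close>, \<open>bar_bar\<close>, \<open>bar_shift_pow\<close>).

  That the operators preserve integrality follows from what they do to the \<open>q\<close>-integers:
  the shift moves the evaluation point \<open>[n]\<close> to \<open>[n + 1]\<close>, and, since \<open>- q [n]\<close> is the image of
  \<open>[- n]\<close> under \<open>q \<mapsto> q\<inverse>\<close>, the value of \<open>bar P\<close> at \<open>[n]\<close> is the conjugate of the value of \<open>P\<close> at
  \<open>[- n]\<close>. So the set of values is permuted and conjugated, and the ring of integral Laurent
  polynomials is closed under conjugation (\<open>poly_shift_qint\<close>, \<open>poly_bar_qint\<close>,
  \<open>bar_coeff_laurent_int\<close>).
\<close>

lemma bar_coeff_to_fract: "bar_coeff (to_fract p) = subst_inv p"
  by (simp add: to_fract_def bar_coeff_Fract)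

lemma bar_coeff_const_q [simp]: "bar_coeff (const_q c) = const_q c"
  by (simp add: const_q_def bar_coeff_to_fract)

lemma bar_coeff_uminus: "bar_coeff (- r) = - bar_coeff r"
  using bar_coeff_add[of r "- r"] by (simp add: eq_neg_iff_add_eq_0 add.commute)

lemma bar_coeff_diff: "bar_coeff (r - s) = bar_coeff r - bar_coeff s"
  using bar_coeff_add[of r "- s"] by (simp add: bar_coeff_uminus)

lemma bar_coeff_inverse: "bar_coeff (inverse r) = inverse (bar_coeff r)"
proof (cases "r = 0")
  case False
  then have "bar_coeff r * bar_coeff (inverse r) = 1"
    by (simp flip: bar_coeff_mult)
  then show ?thesis by (metis inverse_unique)
qed simp

lemma bar_coeff_divide: "bar_coeff (r / s) = bar_coeff r / bar_coeff s"
  by (simp add: divide_inverse bar_coeff_mult bar_coeff_inverse)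

lemma bar_coeff_power: "bar_coeff (r ^ k) = bar_coeff r ^ k"
  by (induction k) (simp_all add: bar_coeff_mult)

lemma bar_coeff_power_int: "bar_coeff (r powi n) = bar_coeff r powi n"
  by (simp add: power_int_def bar_coeff_power bar_coeff_inverse)

lemma bar_coeff_subst_inv: "bar_coeff (subst_inv p) = to_fract p"
proof (induction p)
  case (pCons a p)
  then show ?case
    by (simp add: bar_coeff_add bar_coeff_mult bar_coeff_inverse map_poly_pCons
          flip: poly_const_q_q)
qed simp

lemma bar_coeff_bar_coeff [simp]: "bar_coeff (bar_coeff r) = r"
proof (cases r)
  case (Fract a b)
  then have "bar_coeff (bar_coeff r) = to_fract a / to_fract b"
    by (simp add: bar_coeff_Fract bar_coeff_divide bar_coeff_subst_inv)
  with Fract show ?thesis by (simp add: Fract_conv_to_fract)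
qed

lemma poly_map_poly_bar_coeff:
  "poly (map_poly bar_coeff P) (bar_coeff r) = bar_coeff (poly P r)"
  by (induction P) (simp_all add: map_poly_pCons bar_coeff_add bar_coeff_mult)

text \<open>Substituting \<open>q\<inverse>\<close> into a polynomial reverses its coefficients up to a power of \<open>q\<close>, so the
  conjugate of \<open>p / q\<^sup>k\<close> is again a polynomial with integer coefficients over a power of \<open>q\<close>.\<close>

lemma bar_coeff_laurent_int:
  assumes "r \<in> laurent_int"
  shows "bar_coeff r \<in> laurent_int"
proof -
  obtain p :: "int poly" and k where r: "r = to_fract (map_poly of_int p) / q ^ k"
    using assms by (auto simp: laurent_int_def)
  let ?p = "map_poly of_int p :: rat poly"
  have refl_const: "reflect_poly (map_poly const_q ?p) = map_poly const_q (reflect_poly ?p)"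
    by (rule poly_eqI) (simp add: coeff_reflect_poly coeff_map_poly degree_map_poly)
  have refl_int: "reflect_poly ?p = map_poly of_int (reflect_poly p)"
    by (rule poly_eqI) (simp add: coeff_reflect_poly coeff_map_poly degree_map_poly)
  have "to_fract (reflect_poly ?p) = q ^ degree ?p * subst_inv ?p"
    using poly_reflect_poly_nz[of q "map_poly const_q ?p"]
    by (simp add: refl_const poly_const_q_q subst_inv_def degree_map_poly)
  then have subst: "subst_inv ?p = to_fract (reflect_poly ?p) / q ^ degree ?p"
    by (simp add: field_simps)
  have q_power: "to_fract (monom 1 k) = q ^ k"
  proof (induction k)
    case (Suc k)
    have "monom 1 (Suc k) = [:0, 1:] * (monom 1 k :: rat poly)" by (simp add: monom_Suc)
    with Suc show ?case by (simp only: to_fract_mult q_def power_Suc)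
  qed simp
  have "bar_coeff r = to_fract (monom 1 k * reflect_poly ?p) / q ^ degree ?p"
    by (simp add: r bar_coeff_divide bar_coeff_to_fract bar_coeff_power subst q_power
          power_inverse field_simps)
  also have "monom 1 k * reflect_poly ?p = map_poly of_int (monom 1 k * reflect_poly p)"
    by (rule poly_eqI) (simp add: refl_int coeff_map_poly coeff_monom_mult)
  finally show ?thesis by (auto simp: laurent_int_def)
qed

lemma qint_add_1: "qint (n + 1) = 1 + q * qint n"
  by (simp add: qint_def power_int_add field_simps)

lemma qint_diff_1: "qint (n - 1) = inverse q * (qint n - 1)"
  using qint_add_1[of "n - 1"] by simp

lemma bar_coeff_qint: "bar_coeff (qint (- n)) = - q * qint n"
proof -
  have "bar_coeff (qint (- n)) = (q powi n - 1) / (inverse q - 1)"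
    by (simp add: qint_def bar_coeff_divide bar_coeff_diff bar_coeff_power_int power_int_minus
          bar_coeff_inverse power_int_inverse)
  also have "\<dots> = - q * qint n"
    by (simp add: qint_def field_simps)
  finally show ?thesis .
qed

lemma poly_shift_qint: "poly (shift P) (qint n) = poly P (qint (n + 1))"
  by (simp add: shift_def poly_pcompose qint_add_1 mult.commute)

lemma poly_shift_inv_qint: "poly (shift_inv P) (qint n) = poly P (qint (n - 1))"
  by (simp add: shift_inv_def poly_pcompose qint_diff_1 algebra_simps)

lemma poly_bar_qint: "poly (bar P) (qint n) = bar_coeff (poly P (qint (- n)))"
  by (simp add: bar_def poly_pcompose bar_coeff_qint mult.commute
        flip: poly_map_poly_bar_coeff)

lemma shift_Rq: "P \<in> Rq \<Longrightarrow> shift P \<in> Rq"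
  and shift_inv_Rq: "P \<in> Rq \<Longrightarrow> shift_inv P \<in> Rq"
  and bar_Rq: "P \<in> Rq \<Longrightarrow> bar P \<in> Rq"
  by (simp_all add: Rq_def poly_shift_qint poly_shift_inv_qint poly_bar_qint
        bar_coeff_laurent_int)

lemma shift_pow_Rq:
  assumes "P \<in> Rq"
  shows "shift_pow m P \<in> Rq"
proof -
  have "(shift ^^ k) P \<in> Rq" "(shift_inv ^^ k) P \<in> Rq" for k
    using assms by (induction k) (simp_all add: shift_Rq shift_inv_Rq)
  then show ?thesis by (simp add: shift_pow_def)
qed

lemma bar_0 [simp]: "bar 0 = 0"
  by (simp add: bar_def)

lemma bar_pCons: "bar (pCons a P) = [:bar_coeff a:] + [:0, - q:] * bar P"
  by (simp add: bar_def map_poly_pCons pcompose_pCons)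

lemma bar_bar [simp]: "bar (bar P) = P"
proof (induction P)
  case (pCons a P)
  have "bar [:0, - q:] = [:0, 1:]"
    by (simp add: bar_pCons bar_const bar_coeff_uminus)
  with pCons have "bar (bar (pCons a P)) = [:a:] + [:0, 1:] * P"
    by (simp add: bar_pCons[of a P] bar_add bar_mult bar_const del: mult_pCons_left)
  then show ?case by simp
qed simp

text \<open>Multiplicativity reduces the claim to the generator \<open>x\<close>: conjugating \<open>q x + 1\<close> gives
  \<open>q\<inverse> (- q x) + 1\<close>, and the inverse shift of \<open>- q x\<close> is \<open>- (x - 1)\<close>.\<close>

lemma bar_shift: "bar (shift P) = shift_inv (bar P)"
proof (induction P)
  case 0
  then show ?case by (simp add: shift_def shift_inv_def)
next
  case (pCons a P)
  have "bar (shift (pCons a P)) = [:bar_coeff a:] + [:1, - 1:] * bar (shift P)"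
    by (simp add: shift_def pcompose_pCons bar_add bar_mult bar_const bar_pCons[of 1]
          del: mult_pCons_left)
  also have "\<dots> = shift_inv (bar (pCons a P))"
    unfolding pCons.IH
    by (simp add: shift_inv_def bar_pCons pcompose_add pcompose_mult pcompose_pCons
          del: mult_pCons_left)
  finally show ?case .
qed

lemma bar_shift_inv: "bar (shift_inv P) = shift (bar P)"
  by (metis bar_bar bar_shift)

lemma bar_shift_pow: "bar (shift_pow m P) = shift_pow (- m) (bar P)"
proof -
  have "bar ((shift ^^ k) P) = (shift_inv ^^ k) (bar P)"
    "bar ((shift_inv ^^ k) P) = (shift ^^ k) (bar P)" for k
    by (induction k) (simp_all add: bar_shift bar_shift_inv)
  then show ?thesis by (simp add: shift_pow_def)
qed

lemma shift_pow_shift_pow_uminus: "shift_pow m (shift_pow (- m) P) = P"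
proof -
  have funpow_cancel: "(f ^^ k) ((g ^^ k) P) = P"
    if "\<And>P. f (g P) = P" for f g :: "ratq poly \<Rightarrow> ratq poly" and k
  proof (induction k)
    case (Suc k)
    have "(f ^^ Suc k) ((g ^^ Suc k) P) = (f ^^ k) (f (g ((g ^^ k) P)))"
      by (simp add: funpow_swap1)
    with Suc show ?case by (simp add: that)
  qed simp
  show ?thesis
    by (simp add: shift_pow_def funpow_cancel shift_shift_inv shift_inv_shift)
qed

theorem proposition6p1:
  shows "(\<forall>P\<in>Rq. bar (shift P) = shift_inv (bar P)) \<and>
    (\<forall>m::int.
       (\<forall>P\<in>Rq. shift_pow m (bar P) \<in> Rq) \<and>
       (\<forall>P\<in>Rq. shift_pow m (bar (shift_pow m (bar P))) = P))"
  by (simp add: bar_shift bar_Rq shift_pow_Rq bar_shift_pow shift_pow_shift_pow_uminus)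

end
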